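(* There exist infinitely many (pairwise non-isomorphic) $2$-connected $5$-regular graphs $G$ with $\chi_c'(G) = 6$.
   Context: Graphs are finite and simple (no loops, no parallel edges). For a real number $r$, a circular $r$-edge-colouring of $G$ is a map $c$ assigning to each edge of $G$ a real number in $[0,r)$ such that any two distinct edges $e,f$ sharing an end-vertex satisfy $1\le |c(e)-c(f)|\le r-1$. The circular chromatic index $\chi_c'(G)$ is the infimum (attained for finite graphs) of all $r$ such that $G$ admits a circular $r$-edge-colouring. "$2$-connected" refers to vertex connectivity. *)

theory Defs
  imports Complex_Main
begin

text \<open>
  A graph is given by its vertex set and its edge set, an edge being the unordered pair
  (two-element set) of its end-vertices.
\<close>

record 'a graph =
  verts :: "'a set"
  edges :: "'a set set"

definition simple_graph :: "'a graph \<Rightarrow> bool" where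
  "simple_graph G \<longleftrightarrow>
     finite (verts G) \<and> (\<forall>e\<in>edges G. e \<subseteq> verts G \<and> card e = 2)"

definition degree :: "'a graph \<Rightarrow> 'a \<Rightarrow> nat" where
  "degree G v = card {e \<in> edges G. v \<in> e}"

definition regular :: "nat \<Rightarrow> 'a graph \<Rightarrow> bool" where
  "regular k G \<longleftrightarrow> (\<forall>v\<in>verts G. degree G v = k)"

definition connected_graph :: "'a graph \<Rightarrow> bool" where
  "connected_graph G \<longleftrightarrow>
     verts G \<noteq> {} \<and> (\<forall>u\<in>verts G. \<forall>v\<in>verts G. (u, v) \<in> {(x, y). {x, y} \<in> edges G}\<^sup>*)"

definition delete_verts :: "'a graph \<Rightarrow> 'a set \<Rightarrow> 'a graph" where
  "delete_verts G X = \<lparr>verts = verts G - X, edges = {e \<in> edges G. e \<inter> X = {}}\<rparr>"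

definition vertex_connected :: "nat \<Rightarrow> 'a graph \<Rightarrow> bool" where
  "vertex_connected k G \<longleftrightarrow>
     k < card (verts G) \<and>
     (\<forall>X. X \<subseteq> verts G \<and> card X < k \<longrightarrow> connected_graph (delete_verts G X))"

definition isomorphic :: "'a graph \<Rightarrow> 'b graph \<Rightarrow> bool" where
  "isomorphic G H \<longleftrightarrow>
     (\<exists>\<phi>. bij_betw \<phi> (verts G) (verts H) \<and>
          (\<forall>u\<in>verts G. \<forall>v\<in>verts G. {u, v} \<in> edges G \<longleftrightarrow> {\<phi> u, \<phi> v} \<in> edges H))"

definition circular_edge_colouring :: "'a graph \<Rightarrow> real \<Rightarrow> ('a set \<Rightarrow> real) \<Rightarrow> bool" where
  "circular_edge_colouring G r c \<longleftrightarrow>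
     (\<forall>e\<in>edges G. c e \<in> {0..<r}) \<and>
     (\<forall>e\<in>edges G. \<forall>f\<in>edges G. e \<noteq> f \<and> e \<inter> f \<noteq> {} \<longrightarrow>
        1 \<le> \<bar>c e - c f\<bar> \<and> \<bar>c e - c f\<bar> \<le> r - 1)"

text \<open>
  For a finite graph with at least one edge the set below is nonempty and bounded below by 0,
  so the infimum is the genuine one; for an edgeless graph it is unspecified.
\<close>

definition circular_chromatic_index :: "'a graph \<Rightarrow> real" where
  "circular_chromatic_index G = Inf {r. \<exists>c. circular_edge_colouring G r c}"

end

theory Submission
  imports Defs
begin

text \<open>
  Let $H$ be obtained from $K_6$ by splitting one vertex into two adjacent vertices $P$ and $Q$,
  of degrees 4 and 3. Any graph containing $H$ has no circular $r$-edge-colouring with $r < 6$: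
  taking integer parts of the colours gives a proper 6-edge-colouring in which following adjacent
  edges from colour class $k$ to class $k + 1$ modulo 6 raises the real colour by at least 1
  per step (modulo $r < 6$), so no such walk can close up; but a finite search shows that every
  6-edge-colouring of $H$ has a closed walk. Rotating the real colours so that $PQ$
  has colour 0 forces the other edges at $P$ and $Q$ into the classes 1 to 4 and keeps the
  search small.

  The three missing degrees of $H$ are shared by $P$ and $Q$, so two copies of $H$ can be closed up
  to a 5-regular graph along a Hamiltonian cycle, into which any number of copies of $K_6$ minus
  an edge may be inserted.
\<close>

section \<open>Colourings of the split complete graph\<close>

datatype hv = W1 | W2 | W3 | W4 | W5 | P | Q

text \<open>The order of the edges only affects the size of the search tree.\<close>

definition K5_edges :: "(hv \<times> hv) list" where
  "K5_edges =
     [(W1, W3), (W1, W5), (W1, W2), (W1, W4), (W2, W4), (W3, W4), (W4, W5), (W2, W3), (W3, W5),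
      (W2, W5)]"

definition adj :: "hv \<Rightarrow> hv \<Rightarrow> bool" where
  "adj x y \<longleftrightarrow> (let es = (P, Q) # (W1, P) # (W2, P) # (W3, P) # (W4, Q) # (W5, Q) # K5_edges
                in (x, y) \<in> set es \<or> (y, x) \<in> set es)"

lemma adj_sym: "adj x y \<Longrightarrow> adj y x"
  by (auto simp: adj_def Let_def)

fun occurs :: "hv \<Rightarrow> hv list \<Rightarrow> bool" where
  "occurs x [] = False"
| "occurs x (y # S) = (if y = x then True else occurs x S)"

text \<open>Consecutive edges of a walk need only share an end, as in the line graph, so both ends
  of an edge that meets \<open>S\<close> are kept.\<close>

fun hit :: "hv list \<Rightarrow> (hv \<times> hv) list \<Rightarrow> hv list" where
  "hit S [] = []"
| "hit S ((a, b) # m) =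
     (if occurs a S then a # b # hit S m else if occurs b S then a # b # hit S m else hit S m)"

fun walk :: "hv list \<Rightarrow> (hv \<times> hv) list list \<Rightarrow> hv list" where
  "walk S [] = S"
| "walk S (m # ms) = (case S of [] \<Rightarrow> [] | _ \<Rightarrow> walk (hit S m) ms)"

text \<open>
  A partial colouring is the list of its six colour classes. \<open>search cs es\<close> says that no extension
  of \<open>cs\<close> to \<open>es\<close> is proper and free of closed walks of length 6; \<open>place e es pre post\<close> says
  the same for \<open>pre @ post\<close> and \<open>e # es\<close>, with \<open>e\<close> put into one of the classes \<open>post\<close>.
  They are written with \<open>if\<close> and \<open>case\<close> throughout, so that the simplifier evaluates them lazily.
\<close>

fun search :: "(hv \<times> hv) list list \<Rightarrow> (hv \<times> hv) list \<Rightarrow> bool"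
  and place :: "hv \<times> hv \<Rightarrow> (hv \<times> hv) list \<Rightarrow> (hv \<times> hv) list list \<Rightarrow> (hv \<times> hv) list list \<Rightarrow> bool"
where
  "search cs [] = False"
| "search cs (e # es) = place e es [] cs"
| "place e es pre [] = True"
| "place e es pre (m # post) =
    (if (case hit [fst e, snd e] m of
           [] \<Rightarrow> (case hit (walk [fst e, snd e] (post @ pre)) [e] of
                   [] \<Rightarrow> search (pre @ (e # m) # post) es
                 | _ \<Rightarrow> True)
         | _ \<Rightarrow> True)
     then place e es (pre @ [m]) post else False)"

definition start :: "nat \<Rightarrow> nat \<Rightarrow> nat \<Rightarrow> nat \<Rightarrow> nat \<Rightarrow> (hv \<times> hv) list list" where
  "start a b c d e =
     map (\<lambda>k. map snd (filter (\<lambda>x. fst x = k)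
            [(0, P, Q), (a, W1, P), (b, W2, P), (c, W3, P), (d, W4, Q), (e, W5, Q)])) [0..<6]"

lemma occurs_iff [simp]: "occurs x S \<longleftrightarrow> x \<in> set S"
  by (induction S) auto

lemma set_hit: "set (hit S m) = (\<Union>(a, b) \<in> {e \<in> set m. fst e \<in> set S \<or> snd e \<in> set S}. {a, b})"
  by (induction S m rule: hit.induct) auto

declare walk.simps(2) [simp del]

text \<open>The \<open>case\<close> in \<open>walk\<close> only stops evaluation early:
  \<open>hit\<close> maps the empty list to itself, so the plain recursion is valid.\<close>

lemma walk_Cons [simp]: "walk S (m # ms) = walk (hit S m) ms"
proof -
  have "hit [] m = []" for m
    by (induction m) auto
  moreover from this have "walk [] ms = []" for ms
    by (cases ms) (auto simp: walk.simps(2))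
  ultimately show ?thesis
    by (cases S) (auto simp: walk.simps(2))
qed

lemma walk_append: "walk S (ms @ ns) = walk (walk S ms) ns"
  by (induction ms arbitrary: S) auto

section \<open>Real colours along walks through the classes\<close>

definition circ :: "(hv \<Rightarrow> hv \<Rightarrow> real) \<Rightarrow> real \<Rightarrow> bool" where
  "circ f r \<longleftrightarrow>
     (\<forall>x y. f x y = f y x) \<and> (\<forall>x y. adj x y \<longrightarrow> 0 \<le> f x y \<and> f x y < r) \<and>
     (\<forall>x y z. adj x y \<and> adj x z \<and> y \<noteq> z \<longrightarrow> 1 \<le> \<bar>f x y - f x z\<bar> \<and> \<bar>f x y - f x z\<bar> \<le> r - 1)"

lemma circ_sym: "circ f r \<Longrightarrow> f x y = f y x"
  by (simp add: circ_def)

lemma circ_dist: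
  assumes "circ f r" "adj x y" "adj x z" "y \<noteq> z"
  shows "1 \<le> \<bar>f x y - f x z\<bar>" "\<bar>f x y - f x z\<bar> \<le> r - 1"
  using assms unfolding circ_def by blast+

definition class_ok :: "(hv \<Rightarrow> hv \<Rightarrow> real) \<Rightarrow> nat \<Rightarrow> (hv \<times> hv) list \<Rightarrow> bool" where
  "class_ok f k m \<longleftrightarrow> (\<forall>(u, v) \<in> set m. adj u v \<and> \<lfloor>f u v\<rfloor> = int k)"

definition incident :: "(hv \<Rightarrow> hv \<Rightarrow> real) \<Rightarrow> nat \<Rightarrow> real \<Rightarrow> hv list \<Rightarrow> bool" where
  "incident f k t S \<longleftrightarrow> (\<forall>x \<in> set S. \<exists>y. adj x y \<and> \<lfloor>f x y\<rfloor> = int k \<and> t \<le> f x y)"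

text \<open>Edges of classes \<open>k\<close> and \<open>l\<close> at one vertex are distinct, so
  their colours obey the distance condition, which \<open>step\<close> turns into the new bound.
  Symmetry of \<open>f\<close> gives the bound at both ends.\<close>

lemma incident_hit:
  assumes circ: "circ f r" and S: "incident f k t S" and m: "class_ok f l m" and "l \<noteq> k"
    and step: "\<And>s s'. \<lfloor>s\<rfloor> = int k \<Longrightarrow> \<lfloor>s'\<rfloor> = int l \<Longrightarrow> t \<le> s \<Longrightarrow> 1 \<le> \<bar>s - s'\<bar> \<Longrightarrow> \<bar>s - s'\<bar> \<le> r - 1 \<Longrightarrow> t' \<le> s'"
  shows "incident f l t' (hit S m)"
proof -
  have 1: "t' \<le> f a b" if ab: "adj a b" "\<lfloor>f a b\<rfloor> = int l" and "a \<in> set S" for a b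
  proof -
    obtain y where y: "adj a y" "\<lfloor>f a y\<rfloor> = int k" "t \<le> f a y"
      using S \<open>a \<in> set S\<close> unfolding incident_def by blast
    then have "y \<noteq> b" using ab \<open>l \<noteq> k\<close> by auto
    then show ?thesis
      using step[OF y(2) ab(2) y(3)] circ_dist[OF circ y(1) ab(1)] by blast
  qed
  have 2: "adj a b \<and> \<lfloor>f a b\<rfloor> = int l \<and> t' \<le> f a b \<and> adj b a \<and> f b a = f a b"
    if "(a, b) \<in> set m" "a \<in> set S \<or> b \<in> set S" for a b
  proof -
    have "adj a b" "\<lfloor>f a b\<rfloor> = int l" using m that(1) unfolding class_ok_def by auto
    then show ?thesis
      using 1[of a b] 1[of b a] that(2) adj_sym[of a b] circ_sym[OF circ, of b a] by auto
  qed
  show ?thesis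
    unfolding incident_def set_hit using 2 by (fastforce split: prod.splits)
qed

text \<open>The colour in the higher class is the larger one, so distance at least 1 means a
  rise.\<close>

lemma incident_hit_Suc:
  assumes "circ f r" "incident f k t S" "class_ok f (Suc k) m"
  shows "incident f (Suc k) (t + 1) (hit S m)"
  using assms by (rule incident_hit) (auto simp: abs_if floor_eq_iff split: if_splits)

text \<open>From class 5 to class 0 the colour drops, but by at most \<open>r - 1\<close>: modulo
  \<open>r\<close> this is a rise of at least 1.\<close>

lemma incident_hit_wrap:
  assumes "circ f r" "incident f 5 t S" "class_ok f 0 m"
  shows "incident f 0 (t + 1 - r) (hit S m)"
  using assms by (rule incident_hit) (auto simp: abs_if floor_eq_iff split: if_splits)

lemma incident_walk:
  assumes "circ f r"
  shows "incident f k t S \<Longrightarrow> (\<And>i. i < length ms \<Longrightarrow> class_ok f (Suc (k + i)) (ms ! i)) \<Longrightarrow>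
     incident f (k + length ms) (t + length ms) (walk S ms)"
proof (induction ms arbitrary: k t S)
  case (Cons m ms)
  have "incident f (Suc k) (t + 1) (hit S m)"
    using Cons.prems(2)[of 0] by (intro incident_hit_Suc[OF assms Cons.prems(1)]) auto
  from Cons.IH[OF this] Cons.prems(2)[of "Suc i" for i]
  have "incident f (Suc k + length ms) (t + 1 + length ms) (walk (hit S m) ms)"
    by auto
  then show ?case
    by (simp add: algebra_simps)
qed auto


text \<open>
  Going once round the six classes from an edge \<open>uv\<close> accumulates at least \<open>6 - r > 0\<close>, so the walk
  cannot return to \<open>uv\<close>.
\<close>

lemma no_closed_walk:
  assumes circ: "circ f r" and "r < 6" and uv: "adj u v" "\<lfloor>f u v\<rfloor> = int k"
    and len: "length pre = k" "k + length post = 5"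
    and pre: "\<And>i. i < length pre \<Longrightarrow> class_ok f i (pre ! i)"
    and post: "\<And>i. i < length post \<Longrightarrow> class_ok f (Suc (k + i)) (post ! i)"
  shows "hit (walk [u, v] (post @ pre)) [(u, v)] = []"
proof (rule ccontr)
  assume "hit (walk [u, v] (post @ pre)) [(u, v)] \<noteq> []"
  then obtain x y where x: "x \<in> set (walk [u, v] (post @ pre))" and xy: "adj x y" "f x y = f u v"
    using uv(1) adj_sym[OF uv(1)] circ_sym[OF circ, of u v] by (auto split: if_splits)
  have near: "\<bar>f x y - f x z\<bar> \<le> r - 1 \<and> 1 \<le> \<bar>f x y - f x z\<bar>" if "adj x z" "\<lfloor>f x z\<rfloor> \<noteq> \<lfloor>f x y\<rfloor>" for z
    using circ_dist[OF circ xy(1) that(1)] that(2) by auto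
  have "incident f k (f u v) [u, v]"
    unfolding incident_def using uv adj_sym[OF uv(1)] circ_sym[OF circ, of u v] by auto
  from incident_walk[OF circ this post]
  have "incident f (k + length post) (f u v + length post) (walk [u, v] post)" .
  moreover have "real (length post) = 5 - real k"
    using len(2) by linarith
  ultimately have 1: "incident f 5 (f u v + (5 - k)) (walk [u, v] post)"
    using len(2) by simp
  show False
  proof (cases pre)
    case Nil
    \<comment> \<open>For \<open>k = 0\<close> the walk ends in class 5 without wrapping, at least 5
      above \<open>f u v\<close>, whereas only \<open>r - 1 < 5\<close> is allowed.\<close>
    then obtain z where "adj x z" "\<lfloor>f x z\<rfloor> = 5" "f u v + 5 \<le> f x z"
      using 1 x len unfolding incident_def by auto
    then show False
      using near[of z] xy uv(2) Nil len \<open>r < 6\<close> by auto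
  next
    case (Cons m pre')
    then have "incident f 0 (f u v + (5 - k) + 1 - r) (hit (walk [u, v] post) m)"
      using pre[of 0] by (intro incident_hit_wrap[OF circ 1]) auto
    from incident_walk[OF circ this, of pre']
    have "incident f (length pre') (f u v + (5 - k) + 1 - r + length pre') (walk [u, v] (post @ pre))"
      using pre[of "Suc i" for i] Cons by (auto simp: walk_append)
    \<comment> \<open>The walk ends in class \<open>k - 1\<close>, below \<open>f u v\<close> and
      hence at or below \<open>f u v - 1\<close>; but \<open>f u v + 5 - r\<close> is larger than
      that.\<close>
    then obtain z where "adj x z" "\<lfloor>f x z\<rfloor> = int k - 1" "f u v + 5 - r \<le> f x z"
      using x len Cons unfolding incident_def by (force simp: of_nat_diff algebra_simps)
    then show False
      using near[of z] xy uv(2) \<open>r < 6\<close> by (auto simp: abs_if floor_eq_iff split: if_splits)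
  qed
qed

section \<open>Soundness of the search\<close>

definition classes_ok :: "(hv \<Rightarrow> hv \<Rightarrow> real) \<Rightarrow> (hv \<times> hv) list list \<Rightarrow> bool" where
  "classes_ok f cs \<longleftrightarrow> length cs = 6 \<and> (\<forall>k<6. class_ok f k (cs ! k))"

definition new_edges :: "(hv \<times> hv) list list \<Rightarrow> (hv \<times> hv) list \<Rightarrow> bool" where
  "new_edges cs es \<longleftrightarrow>
     (\<forall>(u, v) \<in> set es. adj u v \<and> (\<forall>m \<in> set cs. (u, v) \<notin> set m \<and> (v, u) \<notin> set m)) \<and>
     distinct (map (\<lambda>(u, v). {u, v}) es)"

text \<open>A real colouring picks one branch of the search tree, putting each edge into the class
  of its integer part. Neither pruning test fires on that branch, which ends in
  \<open>search cs [] = False\<close>. The bound on \<open>length pre\<close> says that the classes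
  already passed over are too low.\<close>

lemma search_sound:
  assumes circ: "circ f r" and "r < 6"
  shows "search cs es \<Longrightarrow> classes_ok f cs \<Longrightarrow> new_edges cs es \<Longrightarrow> False"
    and "place e es pre post \<Longrightarrow> classes_ok f (pre @ post) \<Longrightarrow> new_edges (pre @ post) (e # es) \<Longrightarrow>
      int (length pre) \<le> \<lfloor>f (fst e) (snd e)\<rfloor> \<Longrightarrow> False"
proof (induction cs es and e es pre post rule: search_place.induct)
  case (1 cs)
  then show ?case by simp
next
  case (2 cs e es)
  have "adj (fst e) (snd e)"
    using "2.prems" by (auto simp: new_edges_def)
  then have "0 \<le> f (fst e) (snd e)"
    using circ unfolding circ_def by blast
  then show ?case
    using "2.prems" by (intro "2.IH") simp_all
next
  case (3 e es pre)
  have "adj (fst e) (snd e)"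
    using "3.prems" by (auto simp: new_edges_def)
  then have "f (fst e) (snd e) < 6"
    using circ \<open>r < 6\<close> unfolding circ_def by (meson less_trans)
  then show ?case
    using 3 by (auto simp: classes_ok_def le_floor_iff)
next
  case (4 e es pre m post)
  obtain u v where e: "e = (u, v)" by (cases e)
  have adj: "adj u v" and new: "(u, v) \<notin> set m" "(v, u) \<notin> set m"
    using "4.prems" by (auto simp: new_edges_def e)
  let ?k = "length pre"
  have len: "?k + length post = 5"
    using "4.prems" by (auto simp: classes_ok_def)
  have ok: "class_ok f i ((pre @ m # post) ! i)" if "i < 6" for i
    using "4.prems" that by (auto simp: classes_ok_def)
  have m: "class_ok f ?k m"
    using ok[of ?k] len by auto
  show ?case
  proof (cases "\<lfloor>f u v\<rfloor> = int ?k")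
    case True
    have "hit [u, v] m = []"
    proof (rule ccontr)
      assume "hit [u, v] m \<noteq> []"
      then have "set (hit [u, v] m) \<noteq> {}" by simp
      then obtain a b where ab: "(a, b) \<in> set m" "a \<in> {u, v} \<or> b \<in> {u, v}"
        unfolding set_hit by auto
      have ab': "adj a b" "\<lfloor>f a b\<rfloor> = int ?k" "adj b a" "f b a = f a b"
        using m ab(1) adj_sym circ_sym[OF circ] unfolding class_ok_def by auto
      \<comment> \<open>Both edges are oriented away from a common end \<open>x\<close>; two colours
        in one class differ by less than 1.\<close>
      obtain x y z where xyz: "adj x y" "adj x z" "y \<noteq> z" "f x y = f u v" "f x z = f a b"
        using ab new ab' adj adj_sym[OF adj] circ_sym[OF circ, of u v] by auto
      then have "1 \<le> \<bar>f u v - f a b\<bar>"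
        using circ_dist(1)[OF circ xyz(1-3)] by simp
      then show False
        using True ab'(2) by linarith
    qed
    moreover have "hit (walk [u, v] (post @ pre)) [(u, v)] = []"
    proof (rule no_closed_walk[OF circ \<open>r < 6\<close> adj True refl len])
      show "class_ok f i (pre ! i)" if "i < ?k" for i
        using ok[of i] len that by (simp add: nth_append)
      show "class_ok f (Suc (?k + i)) (post ! i)" if "i < length post" for i
        using ok[of "Suc (?k + i)"] len that by (simp add: nth_append)
    qed
    ultimately have "search (pre @ (e # m) # post) es"
      using "4.prems"(1) by (auto simp: e split: if_splits)
    moreover have "classes_ok f (pre @ (e # m) # post)"
      using "4.prems"(2) adj True unfolding classes_ok_def
      by (auto simp: nth_append nth_Cons' class_ok_def e split: if_splits)
    moreover have "new_edges (pre @ (e # m) # post) es"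
      using "4.prems"(3) by (fastforce simp: new_edges_def e)
    ultimately show ?thesis
      using "4.IH"(1)[unfolded e] \<open>hit [u, v] m = []\<close>
        \<open>hit (walk [u, v] (post @ pre)) [(u, v)] = []\<close>
      unfolding e by simp
  next
    case False
    then have "int (length (pre @ [m])) \<le> \<lfloor>f u v\<rfloor>"
      using "4.prems"(4) by (simp add: e)
    then show ?thesis
      using "4.IH"(2)[unfolded e] "4.prems"(1-3)[unfolded e] by (simp split: if_split_asm)
  qed
qed

section \<open>The finite search and its reduction to sorted colourings\<close>

text \<open>All increasing choices of three classes at \<open>P\<close> and two at \<open>Q\<close>
  from 1 to 4: 24 search trees, checked by evaluation.\<close>

lemma search_starts:
  "\<forall>(a, b, c) \<in> set [(1,2,3),(1,2,4),(1,3,4),(2,3,4)].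
     \<forall>(d, e) \<in> set [(1,2),(1,3),(1,4),(2,3),(2,4),(3,4)]. search (start a b c d e) K5_edges"
  by code_simp

lemma no_sorted_colouring:
  assumes circ: "circ f r" and "r < 6" and "f P Q = 0"
    and P: "f W1 P < f W2 P" "f W2 P < f W3 P" and Q: "f W4 Q < f W5 Q"
  shows False
proof -
  have sym: "f x y = f y x" for x y
    using circ_sym[OF circ] .
  have adj: "adj P Q" "adj P W1" "adj P W2" "adj P W3" "adj Q P" "adj Q W4" "adj Q W5"
    by (auto simp: adj_def)
  note dist = circ_dist[OF circ]
  have b1: "1 \<le> f x y \<and> f x y < 5" if "adj x y" "adj x z" "y \<noteq> z" "f x z = 0" for x y z
  proof -
    have "0 \<le> f x y" using circ that(1) unfolding circ_def by blast
    then show ?thesis using dist[OF that(1-3)] that(4) \<open>r < 6\<close> by auto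
  qed
  have bounds: "1 \<le> f W1 P" "f W3 P < 5" "1 \<le> f W4 Q" "f W5 Q < 5"
    using b1[OF adj(2,1)] b1[OF adj(4,1)] b1[OF adj(6,5)] b1[OF adj(7,5)] \<open>f P Q = 0\<close>
    by (auto simp: sym)
  have gaps: "f W1 P + 1 \<le> f W2 P" "f W2 P + 1 \<le> f W3 P" "f W4 Q + 1 \<le> f W5 Q"
    using dist(1)[OF adj(2,3)] dist(1)[OF adj(3,4)] dist(1)[OF adj(6,7)] P Q
    by (auto simp: sym)
  define a b c d e where "a = nat \<lfloor>f W1 P\<rfloor>" and "b = nat \<lfloor>f W2 P\<rfloor>" and "c = nat \<lfloor>f W3 P\<rfloor>"
    and "d = nat \<lfloor>f W4 Q\<rfloor>" and "e = nat \<lfloor>f W5 Q\<rfloor>"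
  note defs = this
  have fl: "\<lfloor>f W1 P\<rfloor> = int a" "\<lfloor>f W2 P\<rfloor> = int b" "\<lfloor>f W3 P\<rfloor> = int c" "\<lfloor>f W4 Q\<rfloor> = int d" "\<lfloor>f W5 Q\<rfloor> = int e"
    using bounds gaps by (auto simp: defs)
  have "1 \<le> a" "a < b" "b < c" "c \<le> 4" "1 \<le> d" "d < e" "e \<le> 4"
    using bounds gaps fl by linarith+
  then have "(a, b, c) \<in> set [(1,2,3),(1,2,4),(1,3,4),(2,3,4)]"
    and de: "(d, e) \<in> set [(1,2),(1,3),(1,4),(2,3),(2,4),(3,4)]"
    unfolding list.set insert_iff empty_iff prod.inject by presburger+
  from bspec[OF search_starts this(1)]
  have "\<forall>(d, e) \<in> set [(1,2),(1,3),(1,4),(2,3),(2,4),(3,4)]. search (start a b c d e) K5_edges"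
    unfolding prod.case .
  from bspec[OF this de] have search: "search (start a b c d e) K5_edges"
    unfolding prod.case .
  define es where "es = [(0, P, Q), (a, W1, P), (b, W2, P), (c, W3, P), (d, W4, Q), (e, W5, Q)]"
  have start: "start a b c d e = map (\<lambda>k. map snd (filter (\<lambda>x. fst x = k) es)) [0..<6]"
    unfolding start_def es_def ..
  have "classes_ok f (start a b c d e)"
    unfolding classes_ok_def
  proof (intro conjI allI impI)
    fix k :: nat
    assume "k < 6"
    have "set (start a b c d e ! k) = snd ` {x \<in> set es. fst x = k}"
      using \<open>k < 6\<close> unfolding start by simp
    moreover have "adj (fst (snd x)) (snd (snd x)) \<and> \<lfloor>f (fst (snd x)) (snd (snd x))\<rfloor> = int (fst x)" if "x \<in> set es" for x
      using that fl \<open>f P Q = 0\<close> unfolding es_def by (auto simp: adj_def)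
    ultimately show "class_ok f k (start a b c d e ! k)"
      unfolding class_ok_def by auto
  qed (simp add: start_def)
  moreover have "new_edges (start a b c d e) K5_edges"
  proof -
    have *: "(u, v) \<notin> set m \<and> (v, u) \<notin> set m" if "m \<in> set (start a b c d e)" "u \<notin> {P, Q}" "v \<notin> {P, Q}" for m u v
    proof -
      have "snd (snd x) \<in> {P, Q}" if "x \<in> set es" for x
        using that unfolding es_def by auto
      then show ?thesis
        using that unfolding start by fastforce
    qed
    show ?thesis
      unfolding new_edges_def
    proof (intro conjI ballI)
      show "distinct (map (\<lambda>(u, v). {u, v}) K5_edges)"
        by (simp add: K5_edges_def doubleton_eq_iff)
      fix x assume x: "x \<in> set K5_edges"
      then have "adj (fst x) (snd x) \<and> fst x \<notin> {P, Q} \<and> snd x \<notin> {P, Q}"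
        unfolding K5_edges_def adj_def Let_def by auto
      then show "case x of (u, v) \<Rightarrow> adj u v \<and> (\<forall>m \<in> set (start a b c d e). (u, v) \<notin> set m \<and> (v, u) \<notin> set m)"
        using *[of _ "fst x" "snd x"] by (auto simp: split_def)
    qed
  qed
  ultimately show False
    using search_sound(1)[OF circ \<open>r < 6\<close> search] by blast
qed

section \<open>Normalisation by automorphisms and rotation\<close>

lemma circ_permute:
  assumes "circ f r" "inj \<pi>" "\<And>x y. adj x y \<Longrightarrow> adj (\<pi> x) (\<pi> y)"
  shows "circ (\<lambda>x y. f (\<pi> x) (\<pi> y)) r"
  unfolding circ_def
proof (intro conjI allI impI)
  fix x y z
  show "f (\<pi> x) (\<pi> y) = f (\<pi> y) (\<pi> x)"
    by (rule circ_sym[OF assms(1)])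
  show "0 \<le> f (\<pi> x) (\<pi> y)" "f (\<pi> x) (\<pi> y) < r" if "adj x y"
    using assms(1) assms(3)[OF that] unfolding circ_def by blast+
  assume "adj x y \<and> adj x z \<and> y \<noteq> z"
  then have "adj (\<pi> x) (\<pi> y)" "adj (\<pi> x) (\<pi> z)" "\<pi> y \<noteq> \<pi> z"
    using assms(2,3) by (auto dest: injD)
  then show "1 \<le> \<bar>f (\<pi> x) (\<pi> y) - f (\<pi> x) (\<pi> z)\<bar>" "\<bar>f (\<pi> x) (\<pi> y) - f (\<pi> x) (\<pi> z)\<bar> \<le> r - 1"
    using circ_dist[OF assms(1)] by blast+
qed

text \<open>The five \<open>W\<close> vertices are pairwise adjacent, so permuting those at
  \<open>P\<close> and those at \<open>Q\<close> among themselves gives automorphisms of H; the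
  twelve maps are checked by evaluation.\<close>

lemma relabelling:
  assumes "p \<in> set [(W1, W2, W3), (W1, W3, W2), (W2, W1, W3), (W2, W3, W1), (W3, W1, W2), (W3, W2, W1)]"
    and "q \<in> set [(W4, W5), (W5, W4)]"
    and \<pi>: "\<pi> = case_hv (fst p) (fst (snd p)) (snd (snd p)) (fst q) (snd q) P Q"
  shows "inj \<pi>" "adj x y \<Longrightarrow> adj (\<pi> x) (\<pi> y)"
proof -
  let ?hvs = "[W1, W2, W3, W4, W5, P, Q]"
  have hvs: "z \<in> set ?hvs" for z
    by (cases z) auto
  have "\<forall>p \<in> set [(W1, W2, W3), (W1, W3, W2), (W2, W1, W3), (W2, W3, W1), (W3, W1, W2), (W3, W2, W1)].
      \<forall>q \<in> set [(W4, W5), (W5, W4)]. \<forall>x \<in> set ?hvs. \<forall>y \<in> set ?hvs.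
        let \<pi> = case_hv (fst p) (fst (snd p)) (snd (snd p)) (fst q) (snd q) P Q
        in (\<pi> x = \<pi> y \<longrightarrow> x = y) \<and> (adj x y \<longrightarrow> adj (\<pi> x) (\<pi> y))"
    by code_simp
  from bspec[OF bspec[OF bspec[OF bspec[OF this assms(1)] assms(2)] hvs] hvs]
  have *: "(\<pi> x = \<pi> y \<longrightarrow> x = y) \<and> (adj x y \<longrightarrow> adj (\<pi> x) (\<pi> y))" for x y
    unfolding \<pi> Let_def .
  show "inj \<pi>" "adj x y \<Longrightarrow> adj (\<pi> x) (\<pi> y)"
    using * by (auto intro: injI)
qed

text \<open>Colours at a common vertex are distinct, so one of these automorphisms sorts
  them.\<close>

lemma no_rotated_colouring:
  assumes circ: "circ f r" and "r < 6" and "f P Q = 0"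
  shows False
proof -
  have sym: "f x y = f y x" for x y
    using circ_sym[OF circ] .
  have no: False if lt: "f p1 P < f p2 P" "f p2 P < f p3 P" "f q1 Q < f q2 Q"
    and p: "(p1, p2, p3) \<in> set [(W1, W2, W3), (W1, W3, W2), (W2, W1, W3), (W2, W3, W1), (W3, W1, W2), (W3, W2, W1)]"
    and q: "(q1, q2) \<in> set [(W4, W5), (W5, W4)]" for p1 p2 p3 q1 q2
  proof -
    note \<pi> = relabelling[OF p q refl]
    show False
      by (rule no_sorted_colouring[OF circ_permute[OF circ \<pi>] \<open>r < 6\<close>]) (use lt \<open>f P Q = 0\<close> in simp_all)
  qed
  have adj: "adj P W1" "adj P W2" "adj P W3" "adj Q W4" "adj Q W5"
    by (auto simp: adj_def)
  have ne: "f W1 P \<noteq> f W2 P" "f W2 P \<noteq> f W3 P" "f W1 P \<noteq> f W3 P" "f W4 Q \<noteq> f W5 Q"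
    using circ_dist(1)[OF circ adj(1,2)] circ_dist(1)[OF circ adj(2,3)] circ_dist(1)[OF circ adj(1,3)]
      circ_dist(1)[OF circ adj(4,5)] by (auto simp: sym)
  have "\<exists>(q1, q2) \<in> set [(W4, W5), (W5, W4)]. f q1 Q < f q2 Q"
    using ne(4) by auto
  then obtain q1 q2 where q: "(q1, q2) \<in> set [(W4, W5), (W5, W4)]" "f q1 Q < f q2 Q"
    by blast
  have "\<exists>(p1, p2, p3) \<in> set [(W1, W2, W3), (W1, W3, W2), (W2, W1, W3), (W2, W3, W1), (W3, W1, W2), (W3, W2, W1)].
      f p1 P < f p2 P \<and> f p2 P < f p3 P"
    using ne(1-3) by auto
  then obtain p1 p2 p3 where
    "(p1, p2, p3) \<in> set [(W1, W2, W3), (W1, W3, W2), (W2, W1, W3), (W2, W3, W1), (W3, W1, W2), (W3, W2, W1)]"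
    "f p1 P < f p2 P" "f p2 P < f p3 P"
    by blast
  then show False
    using no q by blast
qed

text \<open>Subtracting \<open>t\<close> modulo \<open>r\<close> keeps the absolute value
  \<open>d\<close> of a difference or changes it to \<open>r - d\<close>; the interval from 1 to
  \<open>r - 1\<close> is symmetric under this.\<close>

lemma circ_rotate:
  assumes circ: "circ f r" and "0 \<le> t" "t < r"
  shows "circ (\<lambda>x y. f x y - t + (if f x y < t then r else 0)) r"
  unfolding circ_def
proof (intro conjI allI impI)
  fix x y z
  show "f x y - t + (if f x y < t then r else 0) = f y x - t + (if f y x < t then r else 0)"
    by (simp add: circ_sym[OF circ, of x y])
  show "0 \<le> f x y - t + (if f x y < t then r else 0)" "f x y - t + (if f x y < t then r else 0) < r"
    if "adj x y"
    using circ that assms(2,3) unfolding circ_def by (force split: if_splits)+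
  assume "adj x y \<and> adj x z \<and> y \<noteq> z"
  then have "1 \<le> \<bar>f x y - f x z\<bar>" "\<bar>f x y - f x z\<bar> \<le> r - 1"
    using circ_dist[OF circ] by auto
  then show "1 \<le> \<bar>f x y - t + (if f x y < t then r else 0) - (f x z - t + (if f x z < t then r else 0))\<bar>"
    "\<bar>f x y - t + (if f x y < t then r else 0) - (f x z - t + (if f x z < t then r else 0))\<bar> \<le> r - 1"
    by (auto split: if_splits)
qed

lemma circ_imp_ge_6:
  assumes "circ f r"
  shows "6 \<le> r"
proof (rule ccontr)
  assume "\<not> 6 \<le> r"
  have t: "0 \<le> f P Q" "f P Q < r"
    using assms unfolding circ_def by (auto simp: adj_def)
  show False
    using no_rotated_colouring[OF circ_rotate[OF assms t]] \<open>\<not> 6 \<le> r\<close> by simp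
qed

text \<open>The colouring is pulled back to a copy of H; injectivity of \<open>\<phi>\<close> keeps
  adjacent edges distinct.\<close>

lemma circular_edge_colouring_imp_ge_6:
  assumes c: "circular_edge_colouring G r c" and "inj \<phi>"
    and E: "\<And>x y. adj x y \<Longrightarrow> {\<phi> x, \<phi> y} \<in> edges G"
  shows "6 \<le> r"
proof (rule circ_imp_ge_6)
  show "circ (\<lambda>x y. c {\<phi> x, \<phi> y}) r"
    unfolding circ_def
  proof (intro conjI allI impI)
    fix x y z
    show "c {\<phi> x, \<phi> y} = c {\<phi> y, \<phi> x}"
      by (simp add: insert_commute)
    show "0 \<le> c {\<phi> x, \<phi> y}" "c {\<phi> x, \<phi> y} < r" if "adj x y"
      using c E[OF that] unfolding circular_edge_colouring_def atLeastLessThan_iff by blast+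
    assume "adj x y \<and> adj x z \<and> y \<noteq> z"
    then have "{\<phi> x, \<phi> y} \<in> edges G" "{\<phi> x, \<phi> z} \<in> edges G" "{\<phi> x, \<phi> y} \<noteq> {\<phi> x, \<phi> z}"
      using E by (simp_all add: doubleton_eq_iff inj_eq[OF \<open>inj \<phi>\<close>])
    then show "1 \<le> \<bar>c {\<phi> x, \<phi> y} - c {\<phi> x, \<phi> z}\<bar>" "\<bar>c {\<phi> x, \<phi> y} - c {\<phi> x, \<phi> z}\<bar> \<le> r - 1"
      using c[unfolded circular_edge_colouring_def, THEN conjunct2, rule_format,
          of "{\<phi> x, \<phi> y}" "{\<phi> x, \<phi> z}"] by auto
  qed
qed

section \<open>A family of Hamiltonian 5-regular graphs\<close>

definition nbr_graph :: "nat \<Rightarrow> (nat \<Rightarrow> (nat \<times> nat) list) \<Rightarrow> nat graph" where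
  "nbr_graph N nb = \<lparr>verts = {..<N}, edges = {{v, w} | v w. v < N \<and> w \<in> fst ` set (nb v)}\<rparr>"

text \<open>Each edge is listed at both ends with the same colour, so one local condition gives a
  \<open>d\<close>-regular simple graph together with a proper
  \<open>q\<close>-edge-colouring.\<close>

definition coloured_nbrs :: "nat \<Rightarrow> nat \<Rightarrow> nat \<Rightarrow> (nat \<Rightarrow> (nat \<times> nat) list) \<Rightarrow> bool" where
  "coloured_nbrs N d q nb \<longleftrightarrow>
     (\<forall>v<N. length (nb v) = d \<and> distinct (map fst (nb v)) \<and> distinct (map snd (nb v)) \<and>
        (\<forall>(w, k) \<in> set (nb v). w < N \<and> w \<noteq> v \<and> k < q \<and> (v, k) \<in> set (nb w)))"

lemma coloured_nbrsD:
  assumes "coloured_nbrs N d q nb" "v < N" "(w, k) \<in> set (nb v)"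
  shows "w < N" "w \<noteq> v" "k < q" "(v, k) \<in> set (nb w)"
  using assms unfolding coloured_nbrs_def by blast+

lemma edge_nbr_graph_iff:
  assumes "coloured_nbrs N d q nb"
  shows "{v, w} \<in> edges (nbr_graph N nb) \<longleftrightarrow> v < N \<and> w \<in> fst ` set (nb v)"
proof
  assume "{v, w} \<in> edges (nbr_graph N nb)"
  then obtain v' w' k where vw: "{v, w} = {v', w'}" "v' < N" "(w', k) \<in> set (nb v')"
    unfolding nbr_graph_def by auto
  then show "v < N \<and> w \<in> fst ` set (nb v)"
    using coloured_nbrsD[OF assms vw(2,3)] by (force simp: doubleton_eq_iff)
qed (auto simp: nbr_graph_def)

lemma simple_nbr_graph:
  assumes "coloured_nbrs N d q nb"
  shows "simple_graph (nbr_graph N nb)"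
  unfolding simple_graph_def
proof (intro conjI ballI)
  show "finite (verts (nbr_graph N nb))"
    by (simp add: nbr_graph_def)
  fix e assume "e \<in> edges (nbr_graph N nb)"
  then obtain v w k where "e = {v, w}" "v < N" "(w, k) \<in> set (nb v)"
    unfolding nbr_graph_def by auto
  with coloured_nbrsD(1,2)[OF assms this(2,3)]
  show "e \<subseteq> verts (nbr_graph N nb)" "card e = 2"
    by (auto simp: nbr_graph_def)
qed

lemma regular_nbr_graph:
  assumes "coloured_nbrs N d q nb"
  shows "regular d (nbr_graph N nb)"
  unfolding regular_def
proof
  fix v assume "v \<in> verts (nbr_graph N nb)"
  then have v: "v < N" by (simp add: nbr_graph_def)
  have "{e \<in> edges (nbr_graph N nb). v \<in> e} = (\<lambda>w. {v, w}) ` fst ` set (nb v)"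
  proof (intro set_eqI iffI)
    fix e assume "e \<in> {e \<in> edges (nbr_graph N nb). v \<in> e}"
    then obtain w where "e = {v, w}" "e \<in> edges (nbr_graph N nb)"
      unfolding nbr_graph_def by (auto simp: insert_commute)
    then show "e \<in> (\<lambda>w. {v, w}) ` fst ` set (nb v)"
      using edge_nbr_graph_iff[OF assms] by blast
  next
    fix e assume "e \<in> (\<lambda>w. {v, w}) ` fst ` set (nb v)"
    then show "e \<in> {e \<in> edges (nbr_graph N nb). v \<in> e}"
      using edge_nbr_graph_iff[OF assms] v by blast
  qed
  moreover have "inj (\<lambda>w. {v, w})"
    by (auto simp: inj_def doubleton_eq_iff)
  ultimately have "degree (nbr_graph N nb) v = card (fst ` set (nb v))"
    unfolding degree_def by (simp add: card_image inj_on_subset)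
  also have "\<dots> = length (nb v)"
    using assms v distinct_card[of "map fst (nb v)"] by (simp add: coloured_nbrs_def)
  finally show "degree (nbr_graph N nb) v = d"
    using assms v by (simp add: coloured_nbrs_def)
qed

text \<open>Distinct natural numbers below \<open>q\<close> differ by at least 1 and at most
  \<open>q - 1\<close>, so the listed colours already form a circular colouring.\<close>

lemma circular_edge_colouring_nbr_graph:
  assumes nb: "coloured_nbrs N d q nb"
  shows "\<exists>c. circular_edge_colouring (nbr_graph N nb) (real q) c"
proof -
  let ?G = "nbr_graph N nb"
  have uniq: "k = l" if "(w, k) \<in> set (nb v)" "(w, l) \<in> set (nb v)" "v < N" for v w k l
    using nb that unfolding coloured_nbrs_def by (meson eq_key_imp_eq_value)
  have uniq': "w = u" if "(w, k) \<in> set (nb v)" "(u, k) \<in> set (nb v)" "v < N" for v w u k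
    using nb that unfolding coloured_nbrs_def distinct_map inj_on_def by fastforce
  \<comment> \<open>The colour of an edge is the same at whichever end it is looked up; choice then
    gives a function on edge sets.\<close>
  have "\<exists>k. \<forall>v w l. e = {v, w} \<and> v < N \<and> (w, l) \<in> set (nb v) \<longrightarrow> l = k" for e
  proof (cases "\<exists>v w l. e = {v, w} \<and> v < N \<and> (w, l) \<in> set (nb v)")
    case True
    then obtain v w l where vwl: "e = {v, w}" "v < N" "(w, l) \<in> set (nb v)" by blast
    show ?thesis
      using uniq[OF vwl(3) _ vwl(2)] uniq[OF coloured_nbrsD(4)[OF nb vwl(2,3)] _ coloured_nbrsD(1)[OF nb vwl(2,3)]]
      by (intro exI[of _ l]) (auto simp: vwl(1) doubleton_eq_iff)
  qed blast
  then obtain c where c: "l = c {v, w}" if "v < N" "(w, l) \<in> set (nb v)" for v w l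
    by metis
  have inc: "\<exists>w. e = {v, w} \<and> v < N \<and> (w, c e) \<in> set (nb v)" if e: "e \<in> edges ?G" "v \<in> e" for e v
  proof -
    obtain w where "e = {v, w}"
      using e unfolding nbr_graph_def by (auto simp: insert_commute)
    then have "v < N" "w \<in> fst ` set (nb v)"
      using e edge_nbr_graph_iff[OF nb] by auto
    then show ?thesis
      using c \<open>e = {v, w}\<close> by force
  qed
  have "circular_edge_colouring ?G (real q) (\<lambda>e. real (c e))"
    unfolding circular_edge_colouring_def
  proof (intro conjI ballI impI)
    fix e assume e: "e \<in> edges ?G"
    then obtain v where "v \<in> e" unfolding nbr_graph_def by auto
    then have less: "c e < q"
      using inc[OF e] coloured_nbrsD(3)[OF nb] by blast
    then show "real (c e) \<in> {0..<real q}" by simp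
    fix f assume f: "f \<in> edges ?G" and ef: "e \<noteq> f \<and> e \<inter> f \<noteq> {}"
    then obtain x where x: "x \<in> e" "x \<in> f" by blast
    have "c f < q"
      using inc[OF f x(2)] coloured_nbrsD(3)[OF nb] by blast
    moreover have "c e \<noteq> c f"
      using inc[OF e x(1)] inc[OF f x(2)] uniq' ef by metis
    ultimately show "1 \<le> \<bar>real (c e) - real (c f)\<bar>" "\<bar>real (c e) - real (c f)\<bar> \<le> real q - 1"
      using less by linarith+
  qed
  then show ?thesis by blast
qed

section \<open>2-connectedness from a Hamiltonian cycle\<close>

text \<open>Deleting at most one vertex leaves the whole cycle or a spanning path of the
  rest.\<close>

lemma hamiltonian_vertex_connected_2:
  assumes V: "verts G = {..<N}" and "3 \<le> N"
    and cycle: "\<And>v. v < N \<Longrightarrow> {v, Suc v mod N} \<in> edges G"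
  shows "vertex_connected 2 G"
  unfolding vertex_connected_def
proof (intro conjI allI impI)
  show "2 < card (verts G)" using V \<open>3 \<le> N\<close> by simp
  fix X assume X: "X \<subseteq> verts G \<and> card X < 2"
  then have "finite X" using finite_subset[of X "{..<N}"] V by simp
  obtain x where x: "X \<subseteq> {x}" "x < N"
  proof (cases "X = {}")
    case True
    then show ?thesis using that[of 0] \<open>3 \<le> N\<close> by simp
  next
    case False
    then have "card X = 1" using X \<open>finite X\<close> by (simp add: le_Suc_eq less_Suc_eq numeral_2_eq_2)
    then obtain x where "X = {x}" by (rule card_1_singletonE)
    then show ?thesis using that[of x] X V by auto
  qed
  let ?H = "delete_verts G X"
  let ?R = "{(u, v). {u, v} \<in> edges ?H}"
  \<comment> \<open>The cycle read from \<open>x\<close>: a deleted vertex can only be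
    \<open>u 0 = u N\<close>, and the others are reached in order from \<open>u 1\<close>.\<close>
  define u where "u k = (x + k) mod N" for k
  have u: "u k < N" "{u k, u (Suc k)} \<in> edges G" for k
    using cycle[of "u k"] \<open>3 \<le> N\<close> by (auto simp: u_def mod_Suc_eq)
  have "sym ?R"
    by (auto simp: sym_def insert_commute)
  have u_ne: "u k \<noteq> x" if "0 < k" "k < N" for k
    using that x(2) by (auto simp: u_def mod_if)
  have reach: "(u 1, u k) \<in> ?R\<^sup>*" if "1 \<le> k" "\<forall>i\<in>{1..k}. u i \<notin> X" for k
    using that
  proof (induction k rule: dec_induct)
    case (step k)
    then have "(u k, u (Suc k)) \<in> ?R"
      using u(2)[of k] by (auto simp: delete_verts_def)
    then show ?case
      using step by (auto intro: rtrancl_into_rtrancl)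
  qed simp
  have from_1: "(u 1, v) \<in> ?R\<^sup>*" if v: "v \<in> verts ?H" for v
  proof -
    have "v < N" "v \<notin> X" using v V by (auto simp: delete_verts_def)
    \<comment> \<open>The position of \<open>v\<close> between 1 and \<open>N\<close>; it is
      \<open>N\<close> only for \<open>v = x\<close>, in which case \<open>X\<close> is
      empty.\<close>
    define k where "k = (if x < v then v - x else v + N - x)"
    have "x + k = v \<or> x + k = v + N" and k: "1 \<le> k" "k \<le> N" "k = N \<Longrightarrow> v = x"
      using x(2) \<open>v < N\<close> by (auto simp: k_def split: if_splits)
    then have "u k = v"
      using \<open>v < N\<close> unfolding u_def by auto
    have "u i \<notin> X" if "i \<in> {1..k}" for i
    proof (cases "i = N")
      case True
      then show ?thesis using that k \<open>u k = v\<close> \<open>v \<notin> X\<close> by auto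
    next
      case False
      then show ?thesis using that k u_ne[of i] x by auto
    qed
    then show ?thesis using reach[OF k(1)] \<open>u k = v\<close> by blast
  qed
  have "u 1 \<in> verts ?H"
    using u_ne[of 1] u(1)[of 1] x V \<open>3 \<le> N\<close> by (auto simp: delete_verts_def)
  moreover have "(a, b) \<in> ?R\<^sup>*" if "a \<in> verts ?H" "b \<in> verts ?H" for a b
    using from_1[OF that(1)] from_1[OF that(2)] sym_rtrancl[OF \<open>sym ?R\<close>]
    by (meson rtrancl_trans symD)
  ultimately show "connected_graph ?H"
    unfolding connected_graph_def by blast
qed

section \<open>The chain of blocks and its edge-colouring\<close>

text \<open>
  The list of the neighbours of \<open>v\<close> together with the colours of the connecting edges. The vertices
  0 to 6 (with \<open>P = 0\<close>, \<open>Q = 6\<close>) and 7 to 13 carry the two copies of $H$; for \<open>i \<le> m\<close> the six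
  vertices from \<open>14 + 6 * i\<close> on carry a $K_6$ without the edge of colour 0 between its first and
  last vertex, whose colour is passed on to the edges linking consecutive blocks.
\<close>

fun nbrs :: "nat \<Rightarrow> nat \<Rightarrow> (nat \<times> nat) list" where
  "nbrs m v =
     (if v < 14 then
        [[(1, 1), (2, 2), (3, 4), (6, 3), (19 + 6 * m, 0)],
         [(0, 1), (2, 0), (3, 2), (4, 4), (5, 5)],
         [(0, 2), (1, 0), (3, 5), (4, 3), (5, 4)],
         [(0, 4), (1, 2), (2, 5), (4, 0), (5, 3)],
         [(1, 4), (2, 3), (3, 0), (5, 2), (6, 5)],
         [(1, 5), (2, 4), (3, 3), (4, 2), (6, 0)],
         [(0, 3), (4, 5), (5, 0), (7, 2), (13, 1)],
         [(6, 2), (8, 5), (9, 0), (10, 3), (13, 4)],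
         [(7, 5), (9, 4), (10, 0), (11, 1), (12, 3)],
         [(7, 0), (8, 4), (10, 1), (11, 2), (12, 5)],
         [(7, 3), (8, 0), (9, 1), (11, 5), (12, 4)],
         [(8, 1), (9, 2), (10, 5), (12, 0), (13, 3)],
         [(8, 3), (9, 5), (10, 4), (11, 0), (13, 2)],
         [(14, 0), (6, 1), (7, 4), (11, 3), (12, 2)]] ! v
      else let i = (v - 14) div 6; b = 14 + 6 * i in
        [[(b - 1, 0), (b + 1, 1), (b + 2, 2), (b + 3, 3), (b + 4, 4)],
         [(b, 1), (b + 2, 3), (b + 3, 4), (b + 4, 0), (b + 5, 2)],
         [(b, 2), (b + 1, 3), (b + 3, 0), (b + 4, 1), (b + 5, 4)],
         [(b, 3), (b + 1, 4), (b + 2, 0), (b + 4, 2), (b + 5, 1)],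
         [(b, 4), (b + 1, 0), (b + 2, 1), (b + 3, 2), (b + 5, 3)],
         [(b + 1, 2), (b + 2, 4), (b + 3, 1), (b + 4, 3), (if i < m then b + 6 else 0, 0)]]
        ! ((v - 14) mod 6))"

declare nbrs.simps [simp del]

lemma nbrs_head [simp]:
  "nbrs m 0 = [(1, 1), (2, 2), (3, 4), (6, 3), (19 + 6 * m, 0)]"
  "nbrs m (Suc 0) = [(0, 1), (2, 0), (3, 2), (4, 4), (5, 5)]"
  "nbrs m 2 = [(0, 2), (1, 0), (3, 5), (4, 3), (5, 4)]"
  "nbrs m 3 = [(0, 4), (1, 2), (2, 5), (4, 0), (5, 3)]"
  "nbrs m 4 = [(1, 4), (2, 3), (3, 0), (5, 2), (6, 5)]"
  "nbrs m 5 = [(1, 5), (2, 4), (3, 3), (4, 2), (6, 0)]"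
  "nbrs m 6 = [(0, 3), (4, 5), (5, 0), (7, 2), (13, 1)]"
  "nbrs m 7 = [(6, 2), (8, 5), (9, 0), (10, 3), (13, 4)]"
  "nbrs m 8 = [(7, 5), (9, 4), (10, 0), (11, 1), (12, 3)]"
  "nbrs m 9 = [(7, 0), (8, 4), (10, 1), (11, 2), (12, 5)]"
  "nbrs m 10 = [(7, 3), (8, 0), (9, 1), (11, 5), (12, 4)]"
  "nbrs m 11 = [(8, 1), (9, 2), (10, 5), (12, 0), (13, 3)]"
  "nbrs m 12 = [(8, 3), (9, 5), (10, 4), (11, 0), (13, 2)]"
  "nbrs m 13 = [(14, 0), (6, 1), (7, 4), (11, 3), (12, 2)]"
  by (simp_all add: nbrs.simps)

lemma nbrs_block [simp]:
  "nbrs m (14 + 6 * i) =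
     [(13 + 6 * i, 0), (15 + 6 * i, 1), (16 + 6 * i, 2), (17 + 6 * i, 3), (18 + 6 * i, 4)]"
  "nbrs m (15 + 6 * i) =
     [(14 + 6 * i, 1), (16 + 6 * i, 3), (17 + 6 * i, 4), (18 + 6 * i, 0), (19 + 6 * i, 2)]"
  "nbrs m (16 + 6 * i) =
     [(14 + 6 * i, 2), (15 + 6 * i, 3), (17 + 6 * i, 0), (18 + 6 * i, 1), (19 + 6 * i, 4)]"
  "nbrs m (17 + 6 * i) =
     [(14 + 6 * i, 3), (15 + 6 * i, 4), (16 + 6 * i, 0), (18 + 6 * i, 2), (19 + 6 * i, 1)]"
  "nbrs m (18 + 6 * i) =
     [(14 + 6 * i, 4), (15 + 6 * i, 0), (16 + 6 * i, 1), (17 + 6 * i, 2), (19 + 6 * i, 3)]"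
  "nbrs m (19 + 6 * i) =
     [(15 + 6 * i, 2), (16 + 6 * i, 4), (17 + 6 * i, 1), (18 + 6 * i, 3),
      (if i < m then 20 + 6 * i else 0, 0)]"
proof -
  have *: "(14 + 6 * i + j - 14) div 6 = i" "(14 + 6 * i + j - 14) mod 6 = j" if "j < 6" for j :: nat
    using that by auto
  show "nbrs m (14 + 6 * i) =
     [(13 + 6 * i, 0), (15 + 6 * i, 1), (16 + 6 * i, 2), (17 + 6 * i, 3), (18 + 6 * i, 4)]"
    using *[of 0] by (simp add: nbrs.simps)
  show "nbrs m (15 + 6 * i) =
     [(14 + 6 * i, 1), (16 + 6 * i, 3), (17 + 6 * i, 4), (18 + 6 * i, 0), (19 + 6 * i, 2)]"
    using *[of 1] by (simp add: nbrs.simps)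
  show "nbrs m (16 + 6 * i) =
     [(14 + 6 * i, 2), (15 + 6 * i, 3), (17 + 6 * i, 0), (18 + 6 * i, 1), (19 + 6 * i, 4)]"
    using *[of 2] by (simp add: nbrs.simps)
  show "nbrs m (17 + 6 * i) =
     [(14 + 6 * i, 3), (15 + 6 * i, 4), (16 + 6 * i, 0), (18 + 6 * i, 2), (19 + 6 * i, 1)]"
    using *[of 3] by (simp add: nbrs.simps)
  show "nbrs m (18 + 6 * i) =
     [(14 + 6 * i, 4), (15 + 6 * i, 0), (16 + 6 * i, 1), (17 + 6 * i, 2), (19 + 6 * i, 3)]"
    using *[of 4] by (simp add: nbrs.simps)
  show "nbrs m (19 + 6 * i) =
     [(15 + 6 * i, 2), (16 + 6 * i, 4), (17 + 6 * i, 1), (18 + 6 * i, 3),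
      (if i < m then 20 + 6 * i else 0, 0)]"
    using *[of 5] by (simp add: nbrs.simps)
qed

text \<open>The first vertex of the next block, in the form in which it is listed at the end of a
  block.\<close>

lemma nbrs_block_Suc [simp]:
  "nbrs m (20 + 6 * i) =
     [(19 + 6 * i, 0), (21 + 6 * i, 1), (22 + 6 * i, 2), (23 + 6 * i, 3), (24 + 6 * i, 4)]"
  using nbrs_block(1)[of m "Suc i"] by simp

lemma vertex_cases:
  fixes v m :: nat
  assumes "v < 20 + 6 * m"
  obtains "v < 14" | i where "i \<le> m" "v \<in> {14 + 6 * i, 15 + 6 * i, 16 + 6 * i, 17 + 6 * i, 18 + 6 * i, 19 + 6 * i}"
proof (cases "v < 14")
  case False
  define i j where "i = (v - 14) div 6" and "j = (v - 14) mod 6"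
  have "v = 14 + 6 * i + j" "j < 6"
    using False by (auto simp: i_def j_def)
  then have "v \<in> {14 + 6 * i, 15 + 6 * i, 16 + 6 * i, 17 + 6 * i, 18 + 6 * i, 19 + 6 * i}" "i \<le> m"
    using assms by auto
  then show ?thesis using that(2) by blast
qed (use that in blast)

lemma coloured_nbrs: "coloured_nbrs (20 + 6 * m) 5 6 (nbrs m)"
  unfolding coloured_nbrs_def
proof (intro allI impI)
  fix v assume "v < 20 + 6 * m"
  then show "length (nbrs m v) = 5 \<and> distinct (map fst (nbrs m v)) \<and> distinct (map snd (nbrs m v)) \<and>
    (\<forall>(w, k) \<in> set (nbrs m v). w < 20 + 6 * m \<and> w \<noteq> v \<and> k < 6 \<and> (v, k) \<in> set (nbrs m w))"
  proof (cases rule: vertex_cases)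
    case 1
    then have "v \<in> {0, Suc 0, 2, 3, 4, 5, 6, 7, 8, 9, 10, 11, 12, 13}"
      unfolding insert_iff empty_iff by presburger
    moreover have "nbrs m 14 = [(13, 0), (15, 1), (16, 2), (17, 3), (18, 4)]"
      using nbrs_block(1)[of m 0] by simp
    ultimately show ?thesis by auto
  next
    case (2 i)
    \<comment> \<open>The vertex before a block is 13 for \<open>i = 0\<close> and otherwise the
      last one of the preceding block.\<close>
    moreover have "(14 + 6 * i, 0) \<in> set (nbrs m (13 + 6 * i))"
      using \<open>i \<le> m\<close> by (cases i) auto
    ultimately show ?thesis by (auto split: if_splits)
  qed
qed


definition chain_graph :: "nat \<Rightarrow> nat graph" where
  "chain_graph m = nbr_graph (20 + 6 * m) (nbrs m)"

text \<open>The copy of H on the vertices 0 to 6 gives the lower bound, the colours stored in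
  \<open>nbrs\<close> the upper one.\<close>

lemma circular_chromatic_index_chain_graph: "circular_chromatic_index (chain_graph m) = 6"
  unfolding circular_chromatic_index_def
proof (rule cInf_eq_minimum)
  show "6 \<in> {r. \<exists>c. circular_edge_colouring (chain_graph m) r c}"
    using circular_edge_colouring_nbr_graph[OF coloured_nbrs[of m]] by (simp add: chain_graph_def)
  fix r assume "r \<in> {r. \<exists>c. circular_edge_colouring (chain_graph m) r c}"
  then obtain c where c: "circular_edge_colouring (chain_graph m) r c" by blast
  let ?\<phi> = "case_hv 1 2 3 4 5 0 (6 :: nat)"
  have "inj ?\<phi>"
    by (auto simp: inj_def split: hv.splits)
  moreover have "{?\<phi> x, ?\<phi> y} \<in> edges (chain_graph m)" if "adj x y" for x y
    using that unfolding chain_graph_def edge_nbr_graph_iff[OF coloured_nbrs]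
    by (auto simp: adj_def K5_edges_def)
  ultimately show "6 \<le> r"
    using circular_edge_colouring_imp_ge_6[OF c] by blast
qed

text \<open>The vertices are numbered along a Hamiltonian cycle, closed by the edge from the end of
  the last block to 0.\<close>

lemma vertex_connected_chain_graph: "vertex_connected 2 (chain_graph m)"
proof (rule hamiltonian_vertex_connected_2)
  let ?N = "20 + 6 * m"
  show "verts (chain_graph m) = {..<?N}"
    by (simp add: chain_graph_def nbr_graph_def)
  fix v assume v: "v < ?N"
  have "Suc v mod ?N \<in> fst ` set (nbrs m v)"
    using v
  proof (cases rule: vertex_cases)
    case 1
    then have "v \<in> {0, Suc 0, 2, 3, 4, 5, 6, 7, 8, 9, 10, 11, 12, 13}"
      unfolding insert_iff empty_iff by presburger
    then show ?thesis by auto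
  next
    case (2 i)
    then show ?thesis by (cases "i = m") auto
  qed
  then show "{v, Suc v mod ?N} \<in> edges (chain_graph m)"
    unfolding chain_graph_def edge_nbr_graph_iff[OF coloured_nbrs] using v by simp
qed simp

theorem theorem3:
  "\<exists>S :: nat graph set.
     infinite S \<and>
     (\<forall>G\<in>S. simple_graph G \<and> vertex_connected 2 G \<and> regular 5 G \<and>
             circular_chromatic_index G = 6) \<and>
     pairwise (\<lambda>G H. \<not> isomorphic G H) S"
proof (intro exI conjI ballI)
  \<comment> \<open>The orders are pairwise distinct, which separates the graphs even up to
    isomorphism.\<close>
  have card: "card (verts (chain_graph m)) = 20 + 6 * m" for m
    by (simp add: chain_graph_def nbr_graph_def)
  then have "inj chain_graph"
    by (metis add_left_cancel injI mult_left_cancel zero_neq_numeral)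
  then show "infinite (range chain_graph)"
    using finite_imageD infinite_UNIV_nat by blast
  show "pairwise (\<lambda>G H. \<not> isomorphic G H) (range chain_graph)"
    using card by (auto simp: pairwise_def isomorphic_def dest!: bij_betw_same_card)
  fix G assume "G \<in> range chain_graph"
  then obtain m where G: "G = chain_graph m" by blast
  show "simple_graph G" "regular 5 G"
    unfolding G chain_graph_def
    by (rule simple_nbr_graph[OF coloured_nbrs] regular_nbr_graph[OF coloured_nbrs])+
  show "vertex_connected 2 G" "circular_chromatic_index G = 6"
    unfolding G by (rule vertex_connected_chain_graph circular_chromatic_index_chain_graph)+
qed

end
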